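(* Let $a\in(0,\pi/3)$, let $h\in L_2(5a/2,3a)$ be a nonzero real-valued function, let $\eta$ be a nonzero eigenvalue of the operator $M_h$, put $h_1:=-h/\eta$, and let $e_1$ be an eigenfunction of $M_{h_1}$ related to the eigenvalue $-1$, i.e. $M_{h_1}e_1(x)=-e_1(x)$ for $3a/2<x<2a$. For $\alpha\in\mathbb{C}$ define $$q_{\alpha,1}(x)=\begin{cases}0,& x\in(0,\tfrac{3a}2),\\ \alpha e_1(x),& x\in(\tfrac{3a}2,2a),\\ -\alpha K_{h_1}\big(x+\tfrac a2\big)\displaystyle\int_{3a/2}^{x-a/2}e_1(t)\,dt,& x\in(2a,\tfrac{5a}2),\\ h_1(x),& x\in(\tfrac{5a}2,3a),\\ 0,& x\in(3a,\pi).\end{cases}$$ If $$\int_{3a/2}^{2a}e_1(x)\,dx=0,$$ then, for each $j\in\{0,1\}$, the spectrum of the boundary value problem ${\cal L}_{1,j}(a,q_{\alpha,1})$ is independent of $\alpha\in\mathbb{C}$.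
   Context: For $a\in(0,\pi/3)$ and $h\in L_2(5a/2,3a)$, the integral operator $M_h$ in $L_2(3a/2,2a)$ is $$M_hf(x)=\int_{3a/2}^{7a/2-x}K_h\Big(x+t-\frac a2\Big)f(t)\,dt,\quad \frac{3a}2<x<2a,\qquad K_h(x)=\int_x^{3a}h(\tau)\,d\tau.$$ For real-valued nonzero $h$ it is a nonzero compact Hermitian operator, so it has at least one nonzero eigenvalue. For $j\in\{0,1\}$ and a complex-valued $q\in L_2(0,\pi)$ with $q(x)=0$ on $(0,a)$, ${\cal L}_{1,j}(a,q)$ denotes the boundary value problem $$-y''(x)+q(x)y(x-a)=\lambda y(x),\quad 0<x<\pi,\qquad y'(0)=y^{(j)}(\pi)=0.$$ (The values of $y$ at negative arguments are irrelevant because $q=0$ on $(0,a)$.) Its spectrum is the sequence of its eigenvalues counted with multiplicities, i.e. the zeros with multiplicities of the entire function $\Delta_{1,j}(\lambda)=y_0^{(j)}(\pi,\lambda)$ (derivative with respect to the first argument), where $y_0(x,\lambda)$ is the unique solution of the differential equation $-y''(x)+q(x)y(x-a)=\lambda y(x)$, $0<x<\pi$, with $y_0(0,\lambda)=1$, $y_0'(0,\lambda)=0$. *)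

theory Defs
  imports "HOL-Complex_Analysis.Complex_Analysis"
begin

text \<open>
  Elements of \<open>L\<^sub>2(u, v)\<close> are represented by functions on the whole line; their values outside
  \<open>(u, v)\<close> are never used, and identities between them are understood almost everywhere.
\<close>

definition L2_on :: "real \<Rightarrow> real \<Rightarrow> (real \<Rightarrow> 'a::{banach, second_countable_topology}) \<Rightarrow> bool"
  where "L2_on u v f \<longleftrightarrow>
    set_borel_measurable lebesgue {u<..<v} f \<and>
    set_integrable lebesgue {u<..<v} (\<lambda>x. (norm (f x))\<^sup>2)"

definition ae_zero_on :: "real \<Rightarrow> real \<Rightarrow> (real \<Rightarrow> 'a::zero) \<Rightarrow> bool"
  where "ae_zero_on u v f \<longleftrightarrow> (AE x in lebesgue. x \<in> {u<..<v} \<longrightarrow> f x = 0)"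

definition K_fun :: "real \<Rightarrow> (real \<Rightarrow> complex) \<Rightarrow> real \<Rightarrow> complex"
  where "K_fun a h x = (LINT \<tau>:{x<..<3*a}|lebesgue. h \<tau>)"

definition M_op :: "real \<Rightarrow> (real \<Rightarrow> complex) \<Rightarrow> (real \<Rightarrow> complex) \<Rightarrow> real \<Rightarrow> complex"
  where "M_op a h f x = (LINT t:{3*a/2<..<7*a/2 - x}|lebesgue. K_fun a h (x + t - a/2) * f t)"

definition M_eigenfunction :: "real \<Rightarrow> (real \<Rightarrow> complex) \<Rightarrow> complex \<Rightarrow> (real \<Rightarrow> complex) \<Rightarrow> bool"
  where "M_eigenfunction a h \<eta> f \<longleftrightarrow>
    L2_on (3*a/2) (2*a) f \<and> \<not> ae_zero_on (3*a/2) (2*a) f \<and>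
    (AE x in lebesgue. x \<in> {3*a/2<..<2*a} \<longrightarrow> M_op a h f x = \<eta> * f x)"

definition M_eigenvalue :: "real \<Rightarrow> (real \<Rightarrow> complex) \<Rightarrow> complex \<Rightarrow> bool"
  where "M_eigenvalue a h \<eta> \<longleftrightarrow> (\<exists>f. M_eigenfunction a h \<eta> f)"

text \<open>
  \<open>y\<close> is a solution on \<open>[0, \<pi>]\<close>, in the Caratheodory sense, of \<open>-y'' + q(x) y(x - a) = \<mu> y\<close>, and \<open>dy\<close>
  is its derivative: \<open>dy\<close> is absolutely continuous, i.e. the indefinite Lebesgue integral of an
  integrable function \<open>ddy\<close> (the second derivative of \<open>y\<close>), and the equation holds almost
  everywhere.  For potentials vanishing on \<open>(0, a)\<close> the values of \<open>y\<close> at negative arguments play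
  no role.
\<close>

definition delay_solution ::
    "real \<Rightarrow> (real \<Rightarrow> complex) \<Rightarrow> complex \<Rightarrow> (real \<Rightarrow> complex) \<Rightarrow> (real \<Rightarrow> complex) \<Rightarrow> bool"
  where "delay_solution a q \<mu> y dy \<longleftrightarrow>
    (\<forall>x\<in>{0..pi}. (y has_vector_derivative dy x) (at x within {0..pi})) \<and>
    (\<exists>ddy. set_integrable lebesgue {0<..<pi} ddy \<and>
      (\<forall>x\<in>{0..pi}. dy x = dy 0 + (LINT t:{0<..<x}|lebesgue. ddy t)) \<and>
      (AE x in lebesgue. x \<in> {0<..<pi} \<longrightarrow> - ddy x + q x * y (x - a) = \<mu> * y x))"

text \<open>
  \<open>\<Delta>\<^sub>1\<^sub>,\<^sub>j(\<mu>) = y\<^sub>0\<^sup>(\<^sup>j\<^sup>)(\<pi>, \<mu>)\<close>, used for \<open>j \<in> {0, 1}\<close> only.  The description operator is applied to this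
  value and not to \<open>y\<^sub>0\<close>, because \<open>y\<^sub>0\<close> is unique only on \<open>[0, \<pi>]\<close>.
\<close>

definition char_fun :: "real \<Rightarrow> (real \<Rightarrow> complex) \<Rightarrow> nat \<Rightarrow> complex \<Rightarrow> complex"
  where "char_fun a q j \<mu> =
    (THE d. \<exists>y dy. delay_solution a q \<mu> y dy \<and> y 0 = 1 \<and> dy 0 = 0 \<and>
                   d = (if j = 0 then y pi else dy pi))"

text \<open>The spectrum as the set of all pairs of an eigenvalue and its multiplicity.\<close>

definition spectrum :: "real \<Rightarrow> (real \<Rightarrow> complex) \<Rightarrow> nat \<Rightarrow> (complex \<times> int) set"
  where "spectrum a q j = {(\<mu>, m). char_fun a q j \<mu> = 0 \<and> m = zorder (char_fun a q j) \<mu>}"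

text \<open>The values at the break points (and outside \<open>(0, \<pi>)\<close>) are irrelevant and are set to \<open>0\<close>.\<close>

definition q_alpha ::
    "real \<Rightarrow> (real \<Rightarrow> complex) \<Rightarrow> (real \<Rightarrow> complex) \<Rightarrow> complex \<Rightarrow> real \<Rightarrow> complex"
  where "q_alpha a h\<^sub>1 e\<^sub>1 \<alpha> x =
    (if x \<in> {3*a/2<..<2*a} then \<alpha> * e\<^sub>1 x
     else if x \<in> {2*a<..<5*a/2} then
       - \<alpha> * K_fun a h\<^sub>1 (x + a/2) * (LINT t:{3*a/2<..<x - a/2}|lebesgue. e\<^sub>1 t)
     else if x \<in> {5*a/2<..<3*a} then h\<^sub>1 x
     else 0)"

end

theory Submission
  imports Defs
begin

text \<open>
  Put \<open>b = a/2\<close> and \<open>\<mu> = \<rho>\<^sup>2\<close>.  On \<open>[0, 3b]\<close> every solution is \<open>cos \<rho>x\<close>, so passing from the parameter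
  \<open>\<alpha>\<close> to \<open>\<beta>\<close> adds \<open>(\<beta> - \<alpha>) z\<close> to the solution, where \<open>z'' + \<mu> z = F\<close>, \<open>z = 0\<close> on \<open>[0, 3b]\<close>, and \<open>F\<close>
  lives on \<open>(3b, 6b)\<close>.  It suffices that \<open>z(\<pi>) = z'(\<pi>) = 0\<close>, i.e. that \<open>F\<close> is orthogonal to every
  solution \<open>g\<close> of \<open>g'' + \<mu> g = 0\<close>.  Let \<open>e\<close> and \<open>h\<close> be \<open>e\<^sub>1\<close> and \<open>h\<^sub>1\<close> translated to \<open>(0, b)\<close>, \<open>E\<close> the primitive of
  \<open>e\<close>, and \<open>K(x) = \<integral>\<^sub>x\<^sup>b h\<close>.  Integration by parts turns the eigenvalue relation into
  \<open>e(x) = - \<integral> h(t) E(t - x) dt\<close> over \<open>(x, b)\<close>, so all three pieces of the orthogonality integral take the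
  form \<open>\<integral> h(t) \<integral> E(r) k(t, r) dr dt\<close> over \<open>0 < r < t < b\<close>.  Since \<open>g(x + y) + g(x - y) = 2 g(x) cos \<rho>y\<close>, the
  kernels \<open>k\<close> add up to the constant \<open>- g(2b)\<close>; the integral with \<open>k = 1\<close> is \<open>- \<integral> e = 0\<close>.
\<close>

section \<open>Lebesgue integrals over intervals, and Fubini over a triangle\<close>

text \<open>The functions at hand are only Lebesgue measurable, so Fubini is applied to the product
  of two copies of \<open>lebesgue\<close>. Completion keeps the measure of Borel sets, so the
  countable cover for \<open>lborel\<close> serves again.\<close>

lemma sigma_finite_lebesgue: "sigma_finite_measure (lebesgue :: 'a::euclidean_space measure)"
proof
  obtain A :: "'a set set" where "countable A" "A \<subseteq> sets lborel" "\<Union>A = space lborel"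
      "\<forall>a\<in>A. emeasure lborel a \<noteq> \<infinity>"
    using lborel.sigma_finite_countable by blast
  then show "\<exists>A::'a set set. countable A \<and> A \<subseteq> sets lebesgue \<and> \<Union>A = space lebesgue \<and>
      (\<forall>a\<in>A. emeasure lebesgue a \<noteq> \<infinity>)"
    by (intro exI[of _ A]) (auto simp: subset_iff)
qed

lemma set_integral_cong_AE':
  assumes "set_integrable M A f" "set_integrable M A g" "AE x in M. x \<in> A \<longrightarrow> f x = g x"
  shows "(LINT x:A|M. f x) = (LINT x:A|M. g x)"
  unfolding set_lebesgue_integral_def
proof (rule integral_cong_AE)
  show "AE x in M. indicator A x *\<^sub>R f x = indicator A x *\<^sub>R g x"
    using assms(3) by eventually_elim (auto simp: indicator_def)
qed (use assms(1,2) in \<open>auto simp: set_integrable_def\<close>)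

lemma set_integral_shift:
  fixes f :: "real \<Rightarrow> 'a::euclidean_space"
  shows "(LINT x:{u<..<v}|lebesgue. f (c + x)) = (LINT x:{c + u<..<c + v}|lebesgue. f x)"
proof -
  have "(LINT x:{c + u<..<c + v}|lebesgue. f x)
      = (LINT x|lebesgue. indicator {c + u<..<c + v} (c + 1 * x) *\<^sub>R f (c + 1 * x))"
    unfolding set_lebesgue_integral_def
    by (subst lebesgue_integral_real_affine[where c=1 and t=c]) auto
  then show ?thesis
    by (simp add: set_lebesgue_integral_def indicator_def)
qed

lemma set_integral_reflect:
  fixes f :: "real \<Rightarrow> 'a::euclidean_space"
  shows "(LINT x:{u<..<v}|lebesgue. f (c - x)) = (LINT x:{c - v<..<c - u}|lebesgue. f x)"
proof -
  have "(LINT x:{c - v<..<c - u}|lebesgue. f x)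
      = (LINT x|lebesgue. indicator {c - v<..<c - u} (c + -1 * x) *\<^sub>R f (c + -1 * x))"
    unfolding set_lebesgue_integral_def
    by (subst lebesgue_integral_real_affine[where c="-1" and t=c]) auto
  also have "\<dots> = (LINT x:{u<..<v}|lebesgue. f (c - x))"
    unfolding set_lebesgue_integral_def
    by (rule Bochner_Integration.integral_cong) (auto simp: indicator_def)
  finally show ?thesis ..
qed

lemma set_integrable_shift:
  fixes f :: "real \<Rightarrow> 'a::euclidean_space"
  assumes "set_integrable lebesgue {c + u<..<c + v} f"
  shows "set_integrable lebesgue {u<..<v} (\<lambda>x. f (c + x))"
proof -
  have "integrable lebesgue (\<lambda>x. indicator {c + u<..<c + v} (c + 1 * x) *\<^sub>R f (c + 1 * x))"
    using assms unfolding set_integrable_def by (rule lebesgue_integrable_real_affine) simp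
  then show ?thesis
    by (simp add: set_integrable_def indicator_def)
qed

lemma set_integrable_continuous_Ioo:
  fixes f :: "real \<Rightarrow> 'a::euclidean_space"
  assumes "continuous_on {u..v} f"
  shows "set_integrable lebesgue {u<..<v} f"
  using absolutely_integrable_continuous_real[OF assms] absolutely_integrable_on_Icc_iff_Ioo by blast

lemma set_integral_FTC_Ioo:
  fixes G :: "real \<Rightarrow> 'a::euclidean_space"
  assumes "u \<le> v" and "\<And>x. (G has_vector_derivative g x) (at x)" and "continuous_on UNIV g"
  shows "(LINT t:{u<..<v}|lebesgue. g t) = G v - G u"
proof -
  have "set_integrable lebesgue {u<..<v} g"
    using assms(3) by (intro set_integrable_continuous_Ioo) (rule continuous_on_subset, auto)
  then have "(LINT t:{u<..<v}|lebesgue. g t) = integral {u..v} g"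
    by (simp add: set_lebesgue_integral_eq_integral(2) integral_open_interval_real)
  also have "\<dots> = G v - G u"
    by (intro integral_unique fundamental_theorem_of_calculus assms)
       (auto intro: has_vector_derivative_at_within assms)
  finally show ?thesis .
qed

lemma continuous_on_set_integral_Ioo:
  fixes f :: "real \<Rightarrow> 'a::euclidean_space"
  assumes "set_integrable lebesgue {u<..<v} f"
  shows "continuous_on {u..v} (\<lambda>x. LINT t:{u<..<x}|lebesgue. f t)"
proof -
  have "f integrable_on {u..v}"
    using set_lebesgue_integral_eq_integral(1)[OF assms] integrable_on_Icc_iff_Ioo by blast
  then have "continuous_on {u..v} (\<lambda>x. integral {u..x} f)"
    by (rule indefinite_integral_continuous_1)
  then show ?thesis
  proof (rule continuous_on_eq)
    fix x assume "x \<in> {u..v}"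
    then have "set_integrable lebesgue {u<..<x} f"
      by (intro set_integrable_subset[OF assms]) auto
    then show "integral {u..x} f = (LINT t:{u<..<x}|lebesgue. f t)"
      by (simp add: set_lebesgue_integral_eq_integral(2) integral_open_interval_real)
  qed
qed

lemma continuous_on_set_integral_Ioo_UNIV:
  fixes f :: "real \<Rightarrow> 'a::euclidean_space"
  assumes "integrable lebesgue f"
  shows "continuous_on UNIV (\<lambda>x. LINT t:{u<..<x}|lebesgue. f t)"
proof -
  have "continuous_on {..<v} (\<lambda>x. LINT t:{u<..<x}|lebesgue. f t)" for v
  proof -
    have "set_integrable lebesgue {u<..<max u v} f"
      using assms integrable_mult_indicator[of "{u<..<max u v}" lebesgue f]
      by (simp add: set_integrable_def)
    \<comment> \<open>For \<open>x < u\<close> the interval is empty and the integral is 0, so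
      clamping \<open>x\<close> at \<open>u\<close> changes nothing; this carries continuity over
      from \<open>{u..max u v}\<close>.\<close>
    from continuous_on_set_integral_Ioo[OF this]
    have "continuous_on {..<v} (\<lambda>x. LINT t:{u<..<max u x}|lebesgue. f t)"
      by (rule continuous_on_compose2) (auto intro!: continuous_intros)
    moreover have "(LINT t:{u<..<max u x}|lebesgue. f t) = (LINT t:{u<..<x}|lebesgue. f t)" for x
      by (cases "u \<le> x") (auto simp: max_def)
    ultimately show ?thesis by simp
  qed
  then have "continuous_on (\<Union>v. {..<v}) (\<lambda>x. LINT t:{u<..<x}|lebesgue. f t)"
    by (intro continuous_on_open_UN) auto
  moreover have "(\<Union>v::real. {..<v}) = UNIV"
    using lt_ex gt_ex by auto
  ultimately show ?thesis by simp
qed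

text \<open>The integrand on the triangle \<open>u < s < t < v\<close> is dominated by a constant
  times \<open>|f(t)| |g(s)|\<close>, as the continuous kernel is bounded on the compact square.
  With \<open>k = 1\<close> the lemma acts as integration by parts; with \<open>k t s\<close> a
  function of \<open>t - s\<close> it rearranges convolutions.\<close>

lemma triangle_Fubini:
  fixes f g :: "real \<Rightarrow> complex" and k :: "real \<Rightarrow> real \<Rightarrow> complex"
  assumes f: "set_integrable lebesgue {u<..<v} f" and g: "set_integrable lebesgue {u<..<v} g"
    and k: "continuous_on UNIV (\<lambda>(t, s). k t s)"
  shows "set_integrable lebesgue {u<..<v} (\<lambda>t. f t * (LINT s:{u<..<t}|lebesgue. g s * k t s))"
      (is ?int1)
    and "set_integrable lebesgue {u<..<v} (\<lambda>s. g s * (LINT t:{s<..<v}|lebesgue. f t * k t s))"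
      (is ?int2)
    and "(LINT t:{u<..<v}|lebesgue. f t * (LINT s:{u<..<t}|lebesgue. g s * k t s))
       = (LINT s:{u<..<v}|lebesgue. g s * (LINT t:{s<..<v}|lebesgue. f t * k t s))"
      (is ?eq)
proof -
  interpret L: sigma_finite_measure "lebesgue :: real measure"
    by (rule sigma_finite_lebesgue)
  interpret P: pair_sigma_finite "lebesgue :: real measure" "lebesgue :: real measure" ..
  define F where "F = (\<lambda>t. indicator {u<..<v} t *\<^sub>R f t)"
  define G where "G = (\<lambda>s. indicator {u<..<v} s *\<^sub>R g s)"
  have F: "integrable lebesgue F" and G: "integrable lebesgue G"
    using f g by (auto simp: F_def G_def set_integrable_def)
  have [measurable]: "F \<in> borel_measurable lebesgue" "G \<in> borel_measurable lebesgue"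
    using F G by auto
  have "compact (cbox (u, u) (v, v))" by (rule compact_cbox)
  then have "compact ((\<lambda>(t, s). k t s) ` cbox (u, u) (v, v))"
    by (intro compact_continuous_image continuous_on_subset[OF k]) auto
  then obtain B where "\<forall>x\<in>(\<lambda>(t, s). k t s) ` cbox (u, u) (v, v). norm x \<le> B"
    using compact_imp_bounded bounded_iff by metis
  then have B: "norm (k t s) \<le> B" if "t \<in> {u<..<v}" "s \<in> {u<..<v}" for t s
    using that by force
  \<comment> \<open>The kernel is Borel on the plane, whereas the product carries
    \<open>lebesgue\<close> in each factor; composing both projections with the identity from
    \<open>lebesgue\<close> to Borel bridges the two.\<close>
  have id[measurable]: "(\<lambda>x. x) \<in> borel_measurable (lebesgue :: real measure)"
    by (rule measurable_completion) simp
  have k_meas: "(\<lambda>(t, s). k t s) \<in> borel_measurable (borel \<Otimes>\<^sub>M borel)"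
    using borel_measurable_continuous_onI[OF k] by (simp add: borel_prod)
  have [measurable]: "(\<lambda>p. k (fst p) (snd p)) \<in> borel_measurable (lebesgue \<Otimes>\<^sub>M lebesgue)"
    using measurable_compose[OF measurable_Pair[OF
        measurable_compose[OF measurable_fst id] measurable_compose[OF measurable_snd id]] k_meas]
    by (simp add: case_prod_beta)
  have [measurable]: "Measurable.pred (lebesgue \<Otimes>\<^sub>M lebesgue) (\<lambda>p::real\<times>real. snd p < fst p)"
    using measurable_compose[OF measurable_fst id] measurable_compose[OF measurable_snd id]
    by (rule borel_measurable_pred_less[rotated])
  define H where "H = (\<lambda>t s. if s < t then F t * G s * k t s else 0)"
  have [measurable]: "case_prod H \<in> borel_measurable (lebesgue \<Otimes>\<^sub>M lebesgue)"
    unfolding H_def case_prod_beta by measurable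
  have H_le: "norm (H t s) \<le> norm (F t) * norm (G s) * B" for t s
  \<comment> \<open>The bound \<open>B\<close> is known to be nonnegative only when the square has a
    point; off the square one of \<open>F t\<close>, \<open>G s\<close> is zero and both sides
    vanish.\<close>
  proof (cases "t \<in> {u<..<v} \<and> s \<in> {u<..<v}")
    case True
    then have "0 \<le> B" using B[of t s] norm_ge_zero order_trans by blast
    with True B[of t s] show ?thesis
      by (auto simp: H_def norm_mult intro!: mult_left_mono)
  qed (auto simp: H_def F_def G_def)
  have "integrable (lebesgue \<Otimes>\<^sub>M lebesgue) (\<lambda>(t, s). F t * G s * of_real B)"
  proof (rule P.Fubini_integrable)
    show "integrable lebesgue (\<lambda>t. LINT s|lebesgue. norm (case (t, s) of (t, s) \<Rightarrow> F t * G s * of_real B))"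
      using F G by (simp add: norm_mult)
    show "AE t in lebesgue. integrable lebesgue (\<lambda>s. case (t, s) of (t, s) \<Rightarrow> F t * G s * of_real B)"
      using G by simp
  qed (unfold case_prod_beta, measurable)
  then have H: "integrable (lebesgue \<Otimes>\<^sub>M lebesgue) (case_prod H)"
  proof (rule Bochner_Integration.integrable_bound)
    show "AE p in lebesgue \<Otimes>\<^sub>M lebesgue. norm (case_prod H p)
        \<le> norm (case p of (t, s) \<Rightarrow> F t * G s * of_real B)"
      using H_le by (auto simp: norm_mult intro!: AE_I2 order_trans[OF H_le] mult_left_mono)
  qed measurable
  have 1: "(LINT s|lebesgue. H t s)
      = indicator {u<..<v} t *\<^sub>R (f t * (LINT s:{u<..<t}|lebesgue. g s * k t s))" for t
  proof (cases "t \<in> {u<..<v}")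
    case True
    have "(LINT s|lebesgue. H t s)
        = (LINT s|lebesgue. f t * (indicator {u<..<t} s *\<^sub>R (g s * k t s)))"
      by (rule Bochner_Integration.integral_cong)
         (use True in \<open>auto simp: H_def F_def G_def indicator_def\<close>)
    with True show ?thesis
      by (simp add: set_lebesgue_integral_def del: mult_scaleR_right)
  qed (simp add: H_def F_def cong: if_cong)
  have 2: "(LINT t|lebesgue. H t s)
      = indicator {u<..<v} s *\<^sub>R (g s * (LINT t:{s<..<v}|lebesgue. f t * k t s))" for s
  proof (cases "s \<in> {u<..<v}")
    case True
    have "(LINT t|lebesgue. H t s)
        = (LINT t|lebesgue. g s * (indicator {s<..<v} t *\<^sub>R (f t * k t s)))"
      by (rule Bochner_Integration.integral_cong)
         (use True in \<open>auto simp: H_def F_def G_def indicator_def\<close>)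
    with True show ?thesis
      by (simp add: set_lebesgue_integral_def del: mult_scaleR_right)
  qed (simp add: H_def G_def cong: if_cong)
  show ?int1
    using P.integrable_fst[OF H] by (simp add: 1 set_integrable_def)
  show ?int2
    using P.integrable_snd[OF H] by (simp add: 2 set_integrable_def)
  show ?eq
    using P.Fubini_integral[OF H] by (simp add: 1 2 set_lebesgue_integral_def)
qed

section \<open>Cosine and sine as a fundamental system\<close>

definition cs :: "complex \<Rightarrow> real \<Rightarrow> complex"
  where "cs \<rho> x = cos (\<rho> * of_real x)"

text \<open>The value at \<rho> = 0 is the limit \<open>x\<close>. Thus \<open>cs\<close> and
  \<open>sn\<close> solve \<open>g'' + \<rho>^2 g = 0\<close> with initial data (1, 0) and (0, 1)
  for every complex \<rho>, and the formulas below hold without exception at 0.\<close>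

definition sn :: "complex \<Rightarrow> real \<Rightarrow> complex"
  where "sn \<rho> x = (if \<rho> = 0 then of_real x else sin (\<rho> * of_real x) / \<rho>)"

lemma cs_0 [simp]: "cs \<rho> 0 = 1" and sn_0 [simp]: "sn \<rho> 0 = 0"
  by (simp_all add: cs_def sn_def)

lemma cs_minus [simp]: "cs \<rho> (- x) = cs \<rho> x"
  by (simp add: cs_def)

lemma sn_minus [simp]: "sn \<rho> (- x) = - sn \<rho> x"
  by (simp add: sn_def)

lemma cs_add: "cs \<rho> (x + y) = cs \<rho> x * cs \<rho> y - \<rho>\<^sup>2 * sn \<rho> x * sn \<rho> y"
  by (simp add: cs_def sn_def cos_add ring_distribs power2_eq_square)

lemma sn_add: "sn \<rho> (x + y) = sn \<rho> x * cs \<rho> y + cs \<rho> x * sn \<rho> y"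
  by (simp add: cs_def sn_def sin_add ring_distribs add_divide_distrib)

lemma cs_diff: "cs \<rho> (x - y) = cs \<rho> x * cs \<rho> y + \<rho>\<^sup>2 * sn \<rho> x * sn \<rho> y"
  using cs_add[of \<rho> x "- y"] by simp

lemma sn_diff: "sn \<rho> (x - y) = sn \<rho> x * cs \<rho> y - cs \<rho> x * sn \<rho> y"
  using sn_add[of \<rho> x "- y"] by simp

lemma cs_sn_pythagoras: "(cs \<rho> x)\<^sup>2 + \<rho>\<^sup>2 * (sn \<rho> x)\<^sup>2 = 1"
  using cs_diff[of \<rho> x x] by (simp add: power2_eq_square mult.assoc)

lemma has_vector_derivative_cs: "(cs \<rho> has_vector_derivative - (\<rho>\<^sup>2) * sn \<rho> x) (at x)"
proof -
  have "((\<lambda>z. cos (\<rho> * z)) has_field_derivative - sin (\<rho> * of_real x) * \<rho>) (at (of_real x))"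
    by (auto intro!: derivative_eq_intros)
  from has_vector_derivative_real_field[OF this] show ?thesis
    by (cases "\<rho> = 0") (simp_all add: cs_def[abs_def] sn_def power2_eq_square mult.commute)
qed

lemma has_vector_derivative_sn: "(sn \<rho> has_vector_derivative cs \<rho> x) (at x)"
proof -
  have "((\<lambda>z. if \<rho> = 0 then z else sin (\<rho> * z) / \<rho>) has_field_derivative cos (\<rho> * of_real x))
      (at (of_real x))"
    by (cases "\<rho> = 0") (auto intro!: derivative_eq_intros)
  from has_vector_derivative_real_field[OF this] show ?thesis
    by (simp add: cs_def sn_def[abs_def])
qed

lemma continuous_on_cs [continuous_intros]:
  "continuous_on A f \<Longrightarrow> continuous_on A (\<lambda>x. cs \<rho> (f x))"
  unfolding cs_def by (intro continuous_on_compose2[OF continuous_on_cos[OF continuous_on_id]] continuous_intros) auto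

lemma continuous_on_sn [continuous_intros]:
  "continuous_on A f \<Longrightarrow> continuous_on A (\<lambda>x. sn \<rho> (f x))"
  unfolding sn_def
  by (cases "\<rho> = 0")
     (auto intro!: continuous_intros continuous_on_compose2[OF continuous_on_sin[OF continuous_on_id]])

section \<open>Convolutions and their derivatives\<close>

lemma set_integrable_mult_continuous:
  fixes f \<phi> :: "real \<Rightarrow> complex"
  assumes "set_integrable lebesgue {u<..<v} f" "continuous_on {u..v} \<phi>"
  shows "set_integrable lebesgue {u<..<v} (\<lambda>x. f x * \<phi> x)"
proof -
  have "(\<lambda>x. \<phi> x * f x) absolutely_integrable_on {u<..<v}"
  proof (rule absolutely_integrable_bounded_measurable_product[OF bilinear_times])
    show "\<phi> \<in> borel_measurable (lebesgue_on {u<..<v})"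
      by (rule continuous_imp_measurable_on_sets_lebesgue) (auto intro: continuous_on_subset[OF assms(2)])
    show "bounded (\<phi> ` {u<..<v})"
      by (rule bounded_subset[OF compact_imp_bounded[OF compact_continuous_image[OF assms(2)]]]) auto
  qed (use assms(1) in auto)
  then show ?thesis by (simp add: mult.commute)
qed

text \<open>Made for Duhamel's formula: \<open>conv (sn \<rho>) F\<close> is the solution of
  \<open>z'' + \<rho>^2 z = F\<close> with zero data at 0, and \<open>conv (cs \<rho>) F\<close> is
  its derivative.\<close>

definition conv :: "(real \<Rightarrow> complex) \<Rightarrow> (real \<Rightarrow> complex) \<Rightarrow> real \<Rightarrow> complex"
  where "conv c f x = (LINT t:{0<..<x}|lebesgue. f t * c (x - t))"

text \<open>The Leibniz rule \<open>(c * f)' = c(0) f + c' * f\<close> for convolutions, in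
  integrated form because \<open>f\<close> is merely integrable. Exchanging the order in the double
  integral of \<open>f(s) d(t - s)\<close> leaves an inner integral that the fundamental theorem
  evaluates.\<close>

lemma conv_eq_integral:
  assumes f: "set_integrable lebesgue {0<..<x} f" and x: "0 \<le> x"
    and c: "\<And>t. (c has_vector_derivative d t) (at t)" and d: "continuous_on UNIV d"
  shows "set_integrable lebesgue {0<..<x} (conv d f)"
    and "conv c f x = (LINT t:{0<..<x}|lebesgue. c 0 * f t + conv d f t)"
proof -
  have k: "continuous_on UNIV (\<lambda>(t, s). d (t - s))"
    unfolding case_prod_beta by (intro continuous_on_compose2[OF d]) (auto intro!: continuous_intros)
  have c_cont: "continuous_on UNIV c"
    using has_vector_derivative_continuous[OF c] by (simp add: continuous_at_imp_continuous_on)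
  have one: "set_integrable lebesgue {0<..<x} (\<lambda>_. 1 :: complex)"
    by (intro set_integrable_continuous_Ioo continuous_intros)
  note T = triangle_Fubini[OF one f k]
  show int: "set_integrable lebesgue {0<..<x} (conv d f)"
    using T(1) by (simp add: conv_def[abs_def])
  have inner: "(LINT t:{s<..<x}|lebesgue. d (t - s)) = c (x - s) - c 0" if "s \<le> x" for s
  proof -
    have "(LINT t:{s<..<x}|lebesgue. d (t - s)) = (LINT t:{0<..<x - s}|lebesgue. d t)"
      using set_integral_shift[of s x d "- s"] by simp
    also have "\<dots> = c (x - s) - c 0"
      by (rule set_integral_FTC_Ioo[OF _ c d]) (use that in simp)
    finally show ?thesis .
  qed
  have fc: "set_integrable lebesgue {0<..<x} (\<lambda>s. f s * c (x - s))"
    by (intro set_integrable_mult_continuous[OF f] continuous_on_compose2[OF c_cont])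
       (auto intro!: continuous_intros)
  have f0: "set_integrable lebesgue {0<..<x} (\<lambda>s. c 0 * f s)"
    using f by simp
  have "(LINT t:{0<..<x}|lebesgue. conv d f t)
      = (LINT s:{0<..<x}|lebesgue. f s * (LINT t:{s<..<x}|lebesgue. d (t - s)))"
    using T(3) by (simp add: conv_def[abs_def])
  also have "\<dots> = (LINT s:{0<..<x}|lebesgue. f s * c (x - s) - c 0 * f s)"
    by (rule set_lebesgue_integral_cong) (auto simp: inner algebra_simps)
  also have "\<dots> = conv c f x - (LINT s:{0<..<x}|lebesgue. c 0 * f s)"
    using set_integral_diff(2)[OF fc f0] by (simp add: conv_def)
  finally show "conv c f x = (LINT t:{0<..<x}|lebesgue. c 0 * f t + conv d f t)"
    using set_integral_add(2)[OF f0 int] by simp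
qed

section \<open>The eigenvalue relation and the cancellation of kernels\<close>

text \<open>Two exchanges of the order of integration. The first turns the left side of the
  eigenvalue relation into the integral of \<open>h(t) E(t - x)\<close> over \<open>(x, b)\<close>;
  the second, after multiplication by \<phi>, moves \<open>h\<close> to the outer integral.\<close>

lemma set_integral_Volterra:
  fixes e h \<phi> :: "real \<Rightarrow> complex"
  assumes e: "integrable lebesgue e" and h: "set_integrable lebesgue {0<..<b} h"
    and E_def: "\<And>x. E x = (LINT t:{0<..<x}|lebesgue. e t)"
    and K_def: "\<And>x. K x = (LINT t:{x<..<b}|lebesgue. h t)"
    and eig: "AE x in lebesgue. x \<in> {0<..<b} \<longrightarrow>
        (LINT t:{0<..<b - x}|lebesgue. K (x + t) * e t) = - e x"
    and \<phi>: "continuous_on UNIV \<phi>"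
  shows "(LINT x:{0<..<b}|lebesgue. e x * \<phi> x)
      = - (LINT t:{0<..<b}|lebesgue. h t * (LINT r:{0<..<t}|lebesgue. E r * \<phi> (t - r)))"
proof -
  have e_int: "set_integrable lebesgue {u<..<v} e" for u v
    using e integrable_mult_indicator[of "{u<..<v}" lebesgue e] by (simp add: set_integrable_def)
  have E_cont: "continuous_on UNIV E"
    unfolding E_def by (rule continuous_on_set_integral_Ioo_UNIV[OF e])
  have k1: "continuous_on UNIV (\<lambda>(t, s). 1 :: complex)"
    by (simp add: case_prod_beta)
  have k: "continuous_on UNIV (\<lambda>(t, s). E (t - s))"
    unfolding case_prod_beta by (intro continuous_on_compose2[OF E_cont]) (auto intro!: continuous_intros)
  have eig': "(LINT t:{0<..<b - x}|lebesgue. K (x + t) * e t)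
      = (LINT t:{x<..<b}|lebesgue. h t * E (t - x))" if x: "x \<in> {0<..<b}" for x
  proof -
    have hx: "set_integrable lebesgue {0<..<b - x} (\<lambda>r. h (x + r))"
      by (rule set_integrable_shift, rule set_integrable_subset[OF h]) (use x in auto)
    have K: "K (x + t) = (LINT r:{t<..<b - x}|lebesgue. h (x + r))" for t
      using set_integral_shift[of t "b - x" h x] by (simp add: K_def)
    \<comment> \<open>Fubini with kernel 1: one order of integration produces the primitive
      \<open>E\<close> of \<open>e\<close>, the other the tail integral \<open>K\<close> of
      \<open>h\<close>.\<close>
    have "(LINT t:{0<..<b - x}|lebesgue. h (x + t) * E t)
        = (LINT t:{0<..<b - x}|lebesgue. K (x + t) * e t)"
      using triangle_Fubini(3)[OF hx e_int k1] by (simp add: K E_def mult.commute)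
    then show ?thesis
      using set_integral_shift[of 0 "b - x" "\<lambda>t. h t * E (t - x)" x] by simp
  qed
  have \<phi>_int: "set_integrable lebesgue {0<..<b} \<phi>"
    by (rule set_integrable_continuous_Ioo) (rule continuous_on_subset[OF \<phi>], simp)
  have e\<phi>_int: "set_integrable lebesgue {0<..<b} (\<lambda>x. e x * \<phi> x)"
    by (rule set_integrable_mult_continuous[OF e_int]) (rule continuous_on_subset[OF \<phi>], simp)
  note T = triangle_Fubini[OF h \<phi>_int k]
  have reflect: "(LINT s:{0<..<t}|lebesgue. \<phi> s * E (t - s))
      = (LINT r:{0<..<t}|lebesgue. E r * \<phi> (t - r))" for t
    using set_integral_reflect[of 0 t "\<lambda>r. E r * \<phi> (t - r)" t] by (simp add: mult.commute)
  have "(LINT x:{0<..<b}|lebesgue. e x * \<phi> x)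
      = (LINT x:{0<..<b}|lebesgue. - (\<phi> x * (LINT t:{x<..<b}|lebesgue. h t * E (t - x))))"
  proof (rule set_integral_cong_AE'[OF e\<phi>_int])
    show "AE x in lebesgue. x \<in> {0<..<b} \<longrightarrow>
        e x * \<phi> x = - (\<phi> x * (LINT t:{x<..<b}|lebesgue. h t * E (t - x)))"
      using eig
    proof eventually_elim
      case (elim x)
      then show ?case
        using eig'[of x] by (metis minus_minus mult.commute mult_minus_left)
    qed
  qed (use set_integral_uminus T(2) in \<open>auto simp: set_integrable_def\<close>)
  also have "\<dots> = - (LINT x:{0<..<b}|lebesgue. \<phi> x * (LINT t:{x<..<b}|lebesgue. h t * E (t - x)))"
    by (rule set_integral_uminus[OF T(2)])
  also have "\<dots> = - (LINT t:{0<..<b}|lebesgue. h t * (LINT r:{0<..<t}|lebesgue. E r * \<phi> (t - r)))"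
    by (simp add: T(3)[symmetric] reflect)
  finally show ?thesis .
qed

text \<open>By the product formula, \<open>sn(x - t) cs(b + t)\<close> is the integral of
  \<open>cs(x - b - 2r)\<close> over \<open>t < r < x\<close>; exchanging the order of integration
  then replaces \<open>e\<close> by its primitive \<open>E\<close>.\<close>

lemma conv_sn_eq:
  fixes e :: "real \<Rightarrow> complex"
  assumes e: "integrable lebesgue e" and E_def: "\<And>x. E x = (LINT t:{0<..<x}|lebesgue. e t)"
    and x: "0 \<le> x"
  shows "conv (sn \<rho>) (\<lambda>t. e t * cs \<rho> (b + t)) x
      = (LINT r:{0<..<x}|lebesgue. E r * cs \<rho> (x - b - 2 * r))"
proof -
  have e_int: "set_integrable lebesgue {u<..<v} e" for u v
    using e integrable_mult_indicator[of "{u<..<v}" lebesgue e] by (simp add: set_integrable_def)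
  have cs_int: "set_integrable lebesgue {0<..<x} (\<lambda>r. cs \<rho> (x - b - 2 * r))"
    by (intro set_integrable_continuous_Ioo continuous_intros)
  have k1: "continuous_on UNIV (\<lambda>(t, s). 1 :: complex)"
    by (simp add: case_prod_beta)
  have "(LINT r:{t<..<x}|lebesgue. cs \<rho> (x - b - 2 * r)) = sn \<rho> (x - t) * cs \<rho> (b + t)"
    if t: "t \<in> {0<..<x}" for t
  proof -
    have "((\<lambda>r. - sn \<rho> (x - b - 2 * r) / 2) has_vector_derivative cs \<rho> (x - b - 2 * r)) (at r)" for r
    proof -
      have "((\<lambda>r. x - b - 2 * r) has_real_derivative - 2) (at r)"
        by (auto intro!: derivative_eq_intros)
      from field_vector_diff_chain_at[OF this[unfolded has_real_derivative_iff_has_vector_derivative]]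
      have "((sn \<rho> \<circ> (\<lambda>r. x - b - 2 * r)) has_vector_derivative - 2 *\<^sub>R cs \<rho> (x - b - 2 * r)) (at r)"
        by (intro vector_diff_chain_at has_vector_derivative_sn)
           (auto intro!: derivative_eq_intros simp: has_real_derivative_iff_has_vector_derivative[symmetric])
      from has_vector_derivative_mult_right[OF this, of "- 1 / 2"] show ?thesis
        by (simp add: o_def scaleR_conv_of_real)
    qed
    then have "(LINT r:{t<..<x}|lebesgue. cs \<rho> (x - b - 2 * r))
        = - sn \<rho> (x - b - 2 * x) / 2 - (- sn \<rho> (x - b - 2 * t) / 2)"
      by (intro set_integral_FTC_Ioo[where G="\<lambda>r. - sn \<rho> (x - b - 2 * r) / 2"])
         (use t in \<open>auto intro!: continuous_intros\<close>)
    also have "\<dots> = (sn \<rho> (x + b) + sn \<rho> (x - b - 2 * t)) / 2"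
      using sn_minus[of \<rho> "x + b"] by (simp add: algebra_simps diff_divide_distrib add_divide_distrib)
    \<comment> \<open>The arguments are written as sum and difference of \<open>x - t\<close> and
      \<open>b + t\<close>, so that the addition theorems leave a single product.\<close>
    also have "\<dots> = (sn \<rho> ((x - t) + (b + t)) + sn \<rho> ((x - t) - (b + t))) / 2"
      by (simp add: algebra_simps)
    also have "\<dots> = sn \<rho> (x - t) * cs \<rho> (b + t)"
      unfolding sn_add[of \<rho> "x - t"] sn_diff[of \<rho> "x - t"] by simp
    finally show ?thesis .
  qed
  then have "conv (sn \<rho>) (\<lambda>t. e t * cs \<rho> (b + t)) x
      = (LINT t:{0<..<x}|lebesgue. e t * (LINT r:{t<..<x}|lebesgue. cs \<rho> (x - b - 2 * r)))"
    unfolding conv_def by (intro set_lebesgue_integral_cong) auto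
  then show ?thesis
    using triangle_Fubini(3)[OF cs_int e_int k1] by (simp add: E_def mult.commute)
qed

text \<open>In the notation of the proof the three integrals equal \<open>- I k1 / 2\<close>,
  \<open>I k2 / 2\<close> and \<open>(I k1 + I k2) / 2\<close>. The first two also produce the
  constant kernel \<open>g(2b)\<close>, which \<open>I\<close> annihilates because \<open>e\<close>
  has mean 0.\<close>

lemma eigenfunction_cancellation:
  fixes e h g :: "real \<Rightarrow> complex"
  assumes e: "integrable lebesgue e" and h: "set_integrable lebesgue {0<..<b} h"
    and E_def: "\<And>x. E x = (LINT t:{0<..<x}|lebesgue. e t)"
    and K_def: "\<And>x. K x = (LINT t:{x<..<b}|lebesgue. h t)"
    and eig: "AE x in lebesgue. x \<in> {0<..<b} \<longrightarrow>
        (LINT t:{0<..<b - x}|lebesgue. K (x + t) * e t) = - e x"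
    and mean: "(LINT t:{0<..<b}|lebesgue. e t) = 0"
    and g: "continuous_on UNIV g" and g_add: "\<And>x y. g (x + y) + g (x - y) = 2 * g x * cs \<rho> y"
  shows "(LINT x:{0<..<b}|lebesgue. e x * (g (3 * b + x) * cs \<rho> (b + x)))
      - (LINT x:{0<..<b}|lebesgue. K x * (E x * (g (4 * b + x) * cs \<rho> (2 * b + x))))
      + (LINT x:{0<..<b}|lebesgue. h x * (g (5 * b + x) * conv (sn \<rho>) (\<lambda>t. e t * cs \<rho> (b + t)) x))
      = 0"
proof -
  have E_cont: "continuous_on UNIV E"
    unfolding E_def by (rule continuous_on_set_integral_Ioo_UNIV[OF e])
  have E_int: "set_integrable lebesgue {0<..<v} E" for v
    by (rule set_integrable_continuous_Ioo) (rule continuous_on_subset[OF E_cont], simp)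
  define I where "I = (\<lambda>k. LINT t:{0<..<b}|lebesgue. h t * (LINT r:{0<..<t}|lebesgue. E r * k t r))"
  \<comment> \<open>\<open>kern\<close> is the joint continuity that \<open>triangle_Fubini\<close>
    asks of a kernel; on such kernels \<open>I\<close> is additive.\<close>
  define kern where "kern = (\<lambda>k :: real \<Rightarrow> real \<Rightarrow> complex. continuous_on UNIV (\<lambda>(t, r). k t r))"
  have kernI: "kern k" if "continuous_on UNIV (\<lambda>p. k (fst p) (snd p))" for k
    using that by (simp add: kern_def case_prod_beta)
  have I_int: "set_integrable lebesgue {0<..<b} (\<lambda>t. h t * (LINT r:{0<..<t}|lebesgue. E r * k t r))"
    if "kern k" for k
    using triangle_Fubini(1)[OF h E_int] that by (simp add: kern_def)
  have inner_int: "set_integrable lebesgue {0<..<t} (\<lambda>r. E r * k t r)" if "kern k" for k t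
  proof (rule set_integrable_mult_continuous[OF E_int])
    have "continuous_on {0..t} (\<lambda>r. (\<lambda>(t, r). k t r) (t, r))"
      using that unfolding kern_def by (rule continuous_on_compose2) (auto intro!: continuous_intros)
    then show "continuous_on {0..t} (k t)" by simp
  qed
  have I_add: "I (\<lambda>t r. k t r + l t r) = I k + I l" if "kern k" "kern l" for k l
    unfolding I_def
    by (simp add: ring_distribs set_integral_add inner_int I_int that)
  have I_mult: "I (\<lambda>t r. c * k t r) = c * I k" if "kern k" for c k
    unfolding I_def
    by (simp add: mult.left_commute[of _ c])
  have g': "continuous_on A f \<Longrightarrow> continuous_on A (\<lambda>x. g (f x))" for A :: "'z::topological_space set" and f
    by (rule continuous_on_compose2[OF g]) auto
  note V = set_integral_Volterra[OF e h E_def K_def eig]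
  \<comment> \<open>Taking \<phi> = 1 in the Volterra identity shows that \<open>I 1\<close> is
    minus the integral of \<open>e\<close>. This is where the mean of \<open>e\<close>
    enters.\<close>
  have I_1: "I (\<lambda>t r. 1) = 0"
    using V[of "\<lambda>_. 1"] mean by (simp add: I_def)
  have I_half: "I (\<lambda>t r. 1 / 2 * (k t r + l t r)) = (I k + I l) / 2" if "kern k" "kern l" for k l
    using I_mult[of "\<lambda>t r. k t r + l t r" "1 / 2"] I_add[OF that] that
    by (simp add: kern_def case_prod_beta continuous_on_add)
  have I_const: "I (\<lambda>t r. c * 1) = 0" for c
    using I_mult[of "\<lambda>t r. 1" c] I_1 by (simp add: kern_def case_prod_beta)
  \<comment> \<open>The sum and difference of the arguments of \<open>g\<close> and
    \<open>cs\<close> are \<open>4b + 2t - 2r\<close> and \<open>2b\<close> in the first integral,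
    \<open>6b + 2r\<close> and \<open>2b\<close> in the second, \<open>4b + 2t - 2r\<close> and
    \<open>6b + 2r\<close> in the third.\<close>
  define k1 where "k1 = (\<lambda>t r. g (4 * b + 2 * t - 2 * r))"
  define k2 where "k2 = (\<lambda>(t::real) r. g (6 * b + 2 * r))"
  have kern: "kern k1" "kern k2" "kern (\<lambda>t r. c * 1)" for c
    by (auto intro!: kernI continuous_intros g' simp: k1_def k2_def)
  have half: "g x * cs \<rho> y = 1 / 2 * (g (x + y) + g (x - y))" for x y
    using g_add[of x y] by simp
  have "(LINT x:{0<..<b}|lebesgue. e x * (g (3 * b + x) * cs \<rho> (b + x)))
      = - I (\<lambda>t r. g (3 * b + (t - r)) * cs \<rho> (b + (t - r)))"
    unfolding I_def by (rule V) (auto intro!: continuous_intros g')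
  also have "\<dots> = - I (\<lambda>t r. 1 / 2 * (k1 t r + g (2 * b) * 1))"
    unfolding half by (intro arg_cong[where f=I] arg_cong[where f=uminus] ext) (simp add: k1_def algebra_simps)
  finally have 1: "(LINT x:{0<..<b}|lebesgue. e x * (g (3 * b + x) * cs \<rho> (b + x))) = - (I k1 / 2)"
    using I_half[OF kern(1) kern(3)] I_const by simp
  have "(LINT x:{0<..<b}|lebesgue. K x * (E x * (g (4 * b + x) * cs \<rho> (2 * b + x))))
      = I (\<lambda>t r. g (4 * b + r) * cs \<rho> (2 * b + r))"
  proof -
    have "set_integrable lebesgue {0<..<b} (\<lambda>x. E x * (g (4 * b + x) * cs \<rho> (2 * b + x)))"
      by (intro set_integrable_mult_continuous[OF E_int]) (auto intro!: continuous_intros g')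
    from triangle_Fubini(3)[OF h this, of "\<lambda>_ _. 1"] show ?thesis
      by (simp add: I_def K_def case_prod_beta mult_ac)
  qed
  also have "\<dots> = I (\<lambda>t r. 1 / 2 * (k2 t r + g (2 * b) * 1))"
    unfolding half by (intro arg_cong[where f=I] arg_cong[where f=uminus] ext) (simp add: k2_def algebra_simps)
  finally have 2: "(LINT x:{0<..<b}|lebesgue. K x * (E x * (g (4 * b + x) * cs \<rho> (2 * b + x)))) = I k2 / 2"
    using I_half[OF kern(2) kern(3)] I_const by simp
  have "(LINT x:{0<..<b}|lebesgue. h x * (g (5 * b + x) * conv (sn \<rho>) (\<lambda>t. e t * cs \<rho> (b + t)) x))
      = I (\<lambda>t r. g (5 * b + t) * cs \<rho> (t - b - 2 * r))"
    unfolding I_def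
  proof (rule set_lebesgue_integral_cong, simp, intro allI impI)
    fix x assume "x \<in> {0<..<b}"
    then show "h x * (g (5 * b + x) * conv (sn \<rho>) (\<lambda>t. e t * cs \<rho> (b + t)) x)
        = h x * (LINT r:{0<..<x}|lebesgue. E r * (g (5 * b + x) * cs \<rho> (x - b - 2 * r)))"
      by (simp add: conv_sn_eq[OF e E_def] mult.left_commute[of _ "g (5 * b + x)"])
  qed
  also have "\<dots> = I (\<lambda>t r. 1 / 2 * (k1 t r + k2 t r))"
    unfolding half by (intro arg_cong[where f=I] arg_cong[where f=uminus] ext) (simp add: k1_def k2_def algebra_simps)
  finally have 3: "(LINT x:{0<..<b}|lebesgue. h x * (g (5 * b + x) * conv (sn \<rho>) (\<lambda>t. e t * cs \<rho> (b + t)) x))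
      = (I k1 + I k2) / 2"
    using I_half[OF kern(1,2)] by simp
  show ?thesis unfolding 1 2 3 by (simp add: field_simps)
qed

section \<open>Solutions before the potential acts, and Duhamel's formula\<close>

text \<open>By constancy of the Wronskians of \<open>y\<close> with the sine and the cosine.\<close>

lemma delay_solution_initial_segment:
  assumes sol: "delay_solution a q (\<rho>\<^sup>2) y dy" and init: "y 0 = 1" "dy 0 = 0"
    and X: "X \<le> pi" and q: "\<And>x. x \<in> {0<..<X} \<Longrightarrow> q x = 0" and x: "x \<in> {0..X}"
  shows "y x = cs \<rho> x"
proof -
  obtain ddy where ddy: "set_integrable lebesgue {0<..<pi} ddy"
    and dy: "\<And>x. x \<in> {0..pi} \<Longrightarrow> dy x = dy 0 + (LINT t:{0<..<x}|lebesgue. ddy t)"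
    and eq: "AE x in lebesgue. x \<in> {0<..<pi} \<longrightarrow> - ddy x + q x * y (x - a) = \<rho>\<^sup>2 * y x"
    and y: "\<And>x. x \<in> {0..pi} \<Longrightarrow> (y has_vector_derivative dy x) (at x within {0..pi})"
    using sol unfolding delay_solution_def by blast
  have y': "(y has_vector_derivative dy x) (at x within {0..X})" if "x \<in> {0..X}" for x
    by (rule has_vector_derivative_within_subset[OF y]) (use that X in auto)
  have y_cont: "continuous_on {0..X} y"
    using has_vector_derivative_continuous[OF y'] by (simp add: continuous_on_eq_continuous_within)
  \<comment> \<open>Where \<open>q\<close> vanishes the delayed term drops out, whatever the value
    \<open>y (x - a)\<close>, and \<open>dy\<close> becomes the integral of a continuous function;
    hence it is differentiable at every point of \<open>[0, X]\<close>.\<close>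
  have dy_eq: "dy x = integral {0..x} (\<lambda>t. - (\<rho>\<^sup>2) * y t)" if "x \<in> {0..X}" for x
  proof -
    have int: "set_integrable lebesgue {0<..<x} (\<lambda>t. - (\<rho>\<^sup>2) * y t)"
      by (intro set_integrable_continuous_Ioo continuous_intros continuous_on_subset[OF y_cont])
         (use that in auto)
    have "(LINT t:{0<..<x}|lebesgue. ddy t) = (LINT t:{0<..<x}|lebesgue. - (\<rho>\<^sup>2) * y t)"
    proof (rule set_integral_cong_AE'[OF _ int])
      show "set_integrable lebesgue {0<..<x} ddy"
        by (rule set_integrable_subset[OF ddy]) (use that X in auto)
      show "AE t in lebesgue. t \<in> {0<..<x} \<longrightarrow> ddy t = - (\<rho>\<^sup>2) * y t"
        using eq
      proof eventually_elim
        case (elim t)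
        show ?case
        proof
          assume "t \<in> {0<..<x}"
          with elim q[of t] that X have "- ddy t = \<rho>\<^sup>2 * y t"
            by auto
          then show "ddy t = - (\<rho>\<^sup>2) * y t"
            by (metis minus_minus mult_minus_left)
        qed
      qed
    qed
    then show ?thesis
      using dy[of x] that X init set_lebesgue_integral_eq_integral(2)[OF int]
      by (simp add: integral_open_interval_real)
  qed
  have dy': "(dy has_vector_derivative - (\<rho>\<^sup>2) * y x) (at x within {0..X})" if "x \<in> {0..X}" for x
  proof (rule has_vector_derivative_transform[OF that])
    show "((\<lambda>x. integral {0..x} (\<lambda>t. - (\<rho>\<^sup>2) * y t)) has_vector_derivative - (\<rho>\<^sup>2) * y x)
        (at x within {0..X})"
      by (intro integral_has_vector_derivative continuous_intros y_cont that)
  qed (simp add: dy_eq)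
  note cs' = has_vector_derivative_at_within[OF has_vector_derivative_cs]
  note sn' = has_vector_derivative_at_within[OF has_vector_derivative_sn]
  define w where "w = (\<lambda>x. dy x * cs \<rho> x + \<rho>\<^sup>2 * (y x * sn \<rho> x))"
  define v where "v = (\<lambda>x. y x * cs \<rho> x - dy x * sn \<rho> x)"
  have w': "(w has_vector_derivative 0) (at x within {0..X})" if "x \<in> {0..X}" for x
    unfolding w_def
    by (rule has_vector_derivative_eq_rhs, rule has_vector_derivative_add[OF
          has_vector_derivative_mult[OF dy'[OF that] cs']
          has_vector_derivative_mult_right[OF has_vector_derivative_mult[OF y'[OF that] sn']]])
       (simp add: algebra_simps)
  have v': "(v has_vector_derivative 0) (at x within {0..X})" if "x \<in> {0..X}" for x
    unfolding v_def
    by (rule has_vector_derivative_eq_rhs, rule has_vector_derivative_diff[OF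
          has_vector_derivative_mult[OF y'[OF that] cs']
          has_vector_derivative_mult[OF dy'[OF that] sn']])
       (simp add: algebra_simps)
  have 0: "0 \<in> {0..X}" using x by auto
  obtain c where "\<And>x. x \<in> {0..X} \<Longrightarrow> w x = c"
    using has_vector_derivative_zero_constant[OF convex_real_interval(5) w'] by blast
  with x 0 have "w x = w 0" by simp
  then have w: "dy x * cs \<rho> x + \<rho>\<^sup>2 * (y x * sn \<rho> x) = 0"
    using init by (simp add: w_def)
  obtain c' where "\<And>x. x \<in> {0..X} \<Longrightarrow> v x = c'"
    using has_vector_derivative_zero_constant[OF convex_real_interval(5) v'] by blast
  with x 0 have "v x = v 0" by simp
  then have v: "y x * cs \<rho> x - dy x * sn \<rho> x = 1"
    using init by (simp add: v_def)
  \<comment> \<open>The relations \<open>w\<close> and \<open>v\<close> are linear in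
    \<open>y x\<close> and \<open>dy x\<close>; the Pythagorean identity solves them for
    \<open>y x\<close>.\<close>
  have "y x = y x * ((cs \<rho> x)\<^sup>2 + \<rho>\<^sup>2 * (sn \<rho> x)\<^sup>2)"
    by (simp add: cs_sn_pythagoras)
  also have "\<dots> = (y x * cs \<rho> x - dy x * sn \<rho> x) * cs \<rho> x
      + (dy x * cs \<rho> x + \<rho>\<^sup>2 * (y x * sn \<rho> x)) * sn \<rho> x"
    by (simp add: algebra_simps power2_eq_square)
  also have "\<dots> = cs \<rho> x"
    by (simp add: w v)
  finally show ?thesis .
qed

text \<open>Two applications of the Leibniz rule. As \<open>sn\<close> is 0 at 0, the first
  derivative is \<open>conv (cs \<rho>) F\<close>, which is continuous, so it is a derivative at
  every point. As \<open>cs\<close> is 1 at 0, the term \<open>F\<close> appears in the second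
  derivative, which is kept in integrated form to match \<open>delay_solution\<close>.\<close>

lemma conv_sn_solves:
  assumes F: "set_integrable lebesgue {0<..<X} F" and x: "x \<in> {0..X}"
  shows "(conv (sn \<rho>) F has_vector_derivative conv (cs \<rho>) F x) (at x within {0..X})"
    and "set_integrable lebesgue {0<..<X} (\<lambda>t. F t - \<rho>\<^sup>2 * conv (sn \<rho>) F t)"
    and "conv (cs \<rho>) F x = (LINT t:{0<..<x}|lebesgue. F t - \<rho>\<^sup>2 * conv (sn \<rho>) F t)"
proof -
  have F': "set_integrable lebesgue {0<..<t} F" if "t \<in> {0..X}" for t
    by (rule set_integrable_subset[OF F]) (use that in auto)
  have "continuous_on UNIV (cs \<rho>)" "continuous_on UNIV (\<lambda>x. - (\<rho>\<^sup>2) * sn \<rho> x)"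
    by (intro continuous_intros)+
  note S = conv_eq_integral[OF F' _ has_vector_derivative_sn this(1)]
    and C = conv_eq_integral[OF F' _ has_vector_derivative_cs this(2)]
  have conv_sn: "conv (\<lambda>x. - (\<rho>\<^sup>2) * sn \<rho> x) F = (\<lambda>t. - (\<rho>\<^sup>2) * conv (sn \<rho>) F t)"
    unfolding conv_def by (simp only: mult.left_commute[of _ "- (\<rho>\<^sup>2)"] set_integral_mult_right)
  have X: "0 \<le> X" "X \<in> {0..X}" using x by auto
  have int: "set_integrable lebesgue {0<..<X} (\<lambda>t. - (\<rho>\<^sup>2) * conv (sn \<rho>) F t)"
    using C(1)[OF X(2,1)] unfolding conv_sn .
  show int': "set_integrable lebesgue {0<..<X} (\<lambda>t. F t - \<rho>\<^sup>2 * conv (sn \<rho>) F t)"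
    using set_integral_add(1)[OF F int] by simp
  have dz: "conv (cs \<rho>) F x = (LINT t:{0<..<x}|lebesgue. F t - \<rho>\<^sup>2 * conv (sn \<rho>) F t)"
    if "x \<in> {0..X}" for x
    using C(2)[of x] that unfolding conv_sn by simp
  from dz[OF x] show "conv (cs \<rho>) F x = (LINT t:{0<..<x}|lebesgue. F t - \<rho>\<^sup>2 * conv (sn \<rho>) F t)" .
  have dz_cont: "continuous_on {0..X} (conv (cs \<rho>) F)"
    by (rule continuous_on_eq[OF continuous_on_set_integral_Ioo[OF int']]) (simp add: dz)
  show "(conv (sn \<rho>) F has_vector_derivative conv (cs \<rho>) F x) (at x within {0..X})"
  proof (rule has_vector_derivative_transform[OF x])
    show "((\<lambda>x. integral {0..x} (conv (cs \<rho>) F)) has_vector_derivative conv (cs \<rho>) F x)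
        (at x within {0..X})"
      by (rule integral_has_vector_derivative[OF dz_cont x])
    fix t assume t: "t \<in> {0..X}"
    then have "set_integrable lebesgue {0<..<t} (conv (cs \<rho>) F)"
      by (intro set_integrable_continuous_Ioo continuous_on_subset[OF dz_cont]) auto
    then show "conv (sn \<rho>) F t = integral {0..t} (conv (cs \<rho>) F)"
      using S(2)[OF t] t by (simp add: set_lebesgue_integral_eq_integral(2) integral_open_interval_real)
  qed
qed

section \<open>Translated null sets, and integrability of square integrable functions\<close>

lemma AE_lebesgue_shift:
  assumes "AE x in lebesgue. P (x :: real)"
  shows "AE x in lebesgue. P (c + x)"
proof -
  obtain N where "N \<in> null_sets lebesgue" "{x. \<not> P x} \<subseteq> N"
    using assms by (auto simp: eventually_ae_filter)
  then have "negligible {x. \<not> P x}"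
    using negligible_iff_null_sets negligible_subset by blast
  then have "negligible ((+) (- c) ` {x. \<not> P x})"
    by (rule negligible_translation)
  moreover have "(+) (- c) ` {x. \<not> P x} = {x. \<not> P (c + x)}"
    by (force simp: image_iff)
  ultimately show ?thesis
    by (auto simp: eventually_ae_filter negligible_iff_null_sets)
qed

lemma L2_on_imp_set_integrable:
  fixes f :: "real \<Rightarrow> 'a::{banach, second_countable_topology}"
  assumes "L2_on u v f"
  shows "set_integrable lebesgue {u<..<v} f"
proof (rule set_integrable_bound)
  have "set_integrable lebesgue {u<..<v} (\<lambda>_. 1 :: real)"
    by (intro set_integrable_continuous_Ioo continuous_intros)
  then show "set_integrable lebesgue {u<..<v} (\<lambda>x. 1 + (norm (f x))\<^sup>2)"
    using assms by (intro set_integral_add) (auto simp: L2_on_def)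
  \<comment> \<open>A consequence of \<open>(|f(x)| - 1)^2 \<ge> 0\<close>; the dominating function
    is integrable because the interval is bounded.\<close>
  have "norm (f x) \<le> 1 + (norm (f x))\<^sup>2" for x
    using zero_le_power2[of "norm (f x) - 1"] by (simp add: power2_diff) (smt (verit) zero_le_power2)
  then show "AE x in lebesgue. x \<in> {u<..<v} \<longrightarrow> norm (f x) \<le> norm (1 + (norm (f x))\<^sup>2)"
    by (auto intro!: AE_I2 order_trans[OF _ abs_ge_self])
qed (use assms in \<open>simp add: L2_on_def\<close>)

section \<open>The forcing term and the change of parameter\<close>

text \<open>By Duhamel's formula the value and the derivative at \<open>X\<close> of the solution
  driven by \<open>F\<close> are the integrals of \<open>F(t)\<close> against
  \<open>sn(X - t)\<close> and \<open>cs(X - t)\<close>, two instances of \<open>g\<close> in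
  \<open>eigenfunction_cancellation\<close>. The clause on \<open>(5b, 6b)\<close> is not circular:
  there \<open>x - 2b\<close> lies in \<open>(3b, 4b)\<close>, where the convolution sees only the
  first piece of \<open>F\<close>.\<close>

lemma forcing_term_orthogonal:
  fixes e h :: "real \<Rightarrow> complex"
  assumes b: "0 < b" "6 * b < X"
    and e: "integrable lebesgue e" and h: "set_integrable lebesgue {0<..<b} h"
    and E_def: "\<And>x. E x = (LINT t:{0<..<x}|lebesgue. e t)"
    and K_def: "\<And>x. K x = (LINT t:{x<..<b}|lebesgue. h t)"
    and eig: "AE x in lebesgue. x \<in> {0<..<b} \<longrightarrow>
        (LINT t:{0<..<b - x}|lebesgue. K (x + t) * e t) = - e x"
    and mean: "(LINT t:{0<..<b}|lebesgue. e t) = 0"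
  obtains F where "set_integrable lebesgue {0<..<X} F"
    and "\<And>x. x \<in> {3*b<..<4*b} \<Longrightarrow> F x = e (x - 3 * b) * cs \<rho> (x - 2 * b)"
    and "\<And>x. x \<in> {4*b<..<5*b} \<Longrightarrow> F x = - (K (x - 4 * b) * (E (x - 4 * b) * cs \<rho> (x - 2 * b)))"
    and "\<And>x. x \<in> {5*b<..<6*b} \<Longrightarrow> F x = h (x - 5 * b) * conv (sn \<rho>) F (x - 2 * b)"
    and "\<And>x. x \<notin> {3*b<..<4*b} \<union> {4*b<..<5*b} \<union> {5*b<..<6*b} \<Longrightarrow> F x = 0"
    and "\<And>x. x \<le> 3 * b \<Longrightarrow> conv (sn \<rho>) F x = 0"
    and "conv (sn \<rho>) F X = 0" and "conv (cs \<rho>) F X = 0"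
proof -
  define z where "z = conv (sn \<rho>) (\<lambda>t. e t * cs \<rho> (b + t))"
  \<comment> \<open>\<open>F1\<close>, \<open>F2\<close>, \<open>F3\<close> are the forcing terms on \<open>(3b, 4b)\<close>, \<open>(4b, 5b)\<close>, \<open>(5b, 6b)\<close>, translated to \<open>(0, b)\<close>;
    \<open>z\<close> is the solution on \<open>(3b, 4b)\<close>, whose delayed value drives \<open>F3\<close>.\<close>
  define F1 where "F1 = (\<lambda>x. e x * cs \<rho> (b + x))"
  define F2 where "F2 = (\<lambda>x. - (K x * (E x * cs \<rho> (2 * b + x))))"
  define F3 where "F3 = (\<lambda>x. h x * z x)"
  define F where "F = (\<lambda>t.
     if t \<in> {3*b<..<4*b} then F1 (t - 3 * b)
     else if t \<in> {4*b<..<5*b} then F2 (t - 4 * b)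
     else if t \<in> {5*b<..<6*b} then F3 (t - 5 * b) else 0)"
  have e_int: "set_integrable lebesgue {u<..<v} e" for u v
    using e integrable_mult_indicator[of "{u<..<v}" lebesgue e] by (simp add: set_integrable_def)
  have E_cont: "continuous_on UNIV E"
    unfolding E_def by (rule continuous_on_set_integral_Ioo_UNIV[OF e])
  have E_int: "set_integrable lebesgue {0<..<v} E" for v
    by (rule set_integrable_continuous_Ioo) (rule continuous_on_subset[OF E_cont], simp)
  have F1_int: "set_integrable lebesgue {u<..<v} F1" for u v
    unfolding F1_def by (intro set_integrable_mult_continuous e_int continuous_intros)
  have F2_int: "set_integrable lebesgue {0<..<b} F2"
  proof -
    have "set_integrable lebesgue {0<..<b} (\<lambda>x. E x * cs \<rho> (2 * b + x))"
      by (intro set_integrable_mult_continuous E_int continuous_intros)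
    \<comment> \<open>With kernel 1 the inner integral is \<open>K\<close>, so integrability of the
      product with \<open>K\<close> comes out of Fubini.\<close>
    from triangle_Fubini(2)[OF h this, of "\<lambda>_ _. 1"]
    have "set_integrable lebesgue {0<..<b} (\<lambda>x. (- 1) * (K x * (E x * cs \<rho> (2 * b + x))))"
      unfolding K_def by (intro set_integrable_mult_right) (simp add: case_prod_beta mult_ac)
    then show ?thesis by (simp add: F2_def)
  qed
  have z_cont: "continuous_on {0..b} z"
    using has_vector_derivative_continuous[OF conv_sn_solves(1)[OF F1_int[of 0 b], of _ \<rho>]]
    by (simp add: z_def F1_def continuous_on_eq_continuous_within)
  have F3_int: "set_integrable lebesgue {0<..<b} F3"
    unfolding F3_def by (rule set_integrable_mult_continuous[OF h z_cont])
  have shift_int: "set_integrable lebesgue {c<..<c + b} (\<lambda>t. f (t - c))"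
    if "set_integrable lebesgue {0<..<b} f" for f :: "real \<Rightarrow> complex" and c
    using set_integrable_shift[of "- c" c "c + b" f] that by simp
  have ints: "set_integrable lebesgue {3*b<..<4*b} (\<lambda>t. F1 (t - 3 * b))"
      "set_integrable lebesgue {4*b<..<5*b} (\<lambda>t. F2 (t - 4 * b))"
      "set_integrable lebesgue {5*b<..<6*b} (\<lambda>t. F3 (t - 5 * b))"
    using shift_int[OF F1_int, of "3 * b"] shift_int[OF F2_int, of "4 * b"]
      shift_int[OF F3_int, of "5 * b"] by (simp_all add: algebra_simps)
  \<comment> \<open>Here \<open>6b < X\<close> puts all three pieces inside \<open>(0, X)\<close>.
    The factor \<open>u\<close> lets one splitting serve both integrability (\<open>u = 1\<close>)
    and convolutions.\<close>
  have F_split: "indicator {0<..<X} t *\<^sub>R (F t * u) =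
      indicator {3*b<..<4*b} t *\<^sub>R (F1 (t - 3 * b) * u)
      + indicator {4*b<..<5*b} t *\<^sub>R (F2 (t - 4 * b) * u)
      + indicator {5*b<..<6*b} t *\<^sub>R (F3 (t - 5 * b) * u)" for t u
    using b by (auto simp: F_def indicator_def)
  have F_int: "set_integrable lebesgue {0<..<X} F"
    using ints F_split[of _ 1] by (simp add: set_integrable_def)
  have F_conv: "conv c F X = (LINT x:{0<..<b}|lebesgue. F1 x * c (X - (3 * b + x)))
      + (LINT x:{0<..<b}|lebesgue. F2 x * c (X - (4 * b + x)))
      + (LINT x:{0<..<b}|lebesgue. F3 x * c (X - (5 * b + x)))" if c: "continuous_on UNIV c" for c
  proof -
    have "continuous_on A (\<lambda>t. c (X - t))" for A
      by (rule continuous_on_compose2[OF c]) (auto intro!: continuous_intros)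
    note I = ints[THEN set_integrable_mult_continuous[OF _ this]]
    have "conv c F X = (LINT t:{3*b<..<4*b}|lebesgue. F1 (t - 3 * b) * c (X - t))
        + (LINT t:{4*b<..<5*b}|lebesgue. F2 (t - 4 * b) * c (X - t))
        + (LINT t:{5*b<..<6*b}|lebesgue. F3 (t - 5 * b) * c (X - t))"
      using I unfolding conv_def set_lebesgue_integral_def F_split set_integrable_def
      by (simp add: Bochner_Integration.integral_add)
    then show ?thesis
      using set_integral_shift[of 0 b "\<lambda>t. F1 (t - 3 * b) * c (X - t)" "3 * b"]
        set_integral_shift[of 0 b "\<lambda>t. F2 (t - 4 * b) * c (X - t)" "4 * b"]
        set_integral_shift[of 0 b "\<lambda>t. F3 (t - 5 * b) * c (X - t)" "5 * b"]
      by simp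
  qed
  \<comment> \<open>Both \<open>sn\<close> and \<open>cs\<close> satisfy \<open>c_add\<close>. The
    identity survives the substitution of \<open>X - t\<close>, as its left side is symmetric under
    \<open>y\<close> to \<open>-y\<close>.\<close>
  have F_conv_0: "conv c F X = 0"
    if c: "continuous_on UNIV c" and c_add: "\<And>x y. c (x + y) + c (x - y) = 2 * c x * cs \<rho> y" for c
  proof -
    have "continuous_on UNIV (\<lambda>t. c (X - t))"
      by (rule continuous_on_compose2[OF c]) (auto intro!: continuous_intros)
    moreover have "c (X - (x + y)) + c (X - (x - y)) = 2 * c (X - x) * cs \<rho> y" for x y
      using c_add[of "X - x" y] by (simp add: algebra_simps)
    ultimately have "(LINT x:{0<..<b}|lebesgue. e x * (c (X - (3 * b + x)) * cs \<rho> (b + x)))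
      - (LINT x:{0<..<b}|lebesgue. K x * (E x * (c (X - (4 * b + x)) * cs \<rho> (2 * b + x))))
      + (LINT x:{0<..<b}|lebesgue. h x * (c (X - (5 * b + x)) * z x)) = 0"
      unfolding z_def by (rule eigenfunction_cancellation[OF e h E_def K_def eig mean])
    moreover have "(LINT x:{0<..<b}|lebesgue. F2 x * c (X - (4 * b + x)))
        = - (LINT x:{0<..<b}|lebesgue. K x * (E x * (c (X - (4 * b + x)) * cs \<rho> (2 * b + x))))"
      unfolding F2_def set_lebesgue_integral_def
      by (simp add: mult_ac flip: Bochner_Integration.integral_minus)
    ultimately show ?thesis
      unfolding F_conv[OF c] by (simp add: F1_def F3_def mult_ac)
  qed
  have conv_F_z: "conv (sn \<rho>) F (3 * b + x) = z x" if "x \<in> {0..b}" for x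
  proof -
    have "conv (sn \<rho>) F (3 * b + x)
        = (LINT t:{3 * b<..<3 * b + x}|lebesgue. F1 (t - 3 * b) * sn \<rho> (3 * b + x - t))"
      unfolding conv_def set_lebesgue_integral_def
      by (rule Bochner_Integration.integral_cong) (use that b in \<open>auto simp: F_def indicator_def\<close>)
    then show ?thesis
      using set_integral_shift[of 0 x "\<lambda>t. F1 (t - 3 * b) * sn \<rho> (3 * b + x - t)" "3 * b"]
      by (simp add: z_def conv_def F1_def)
  qed
  show thesis
  proof (rule that[OF F_int])
    fix x
    show "F x = e (x - 3 * b) * cs \<rho> (x - 2 * b)" if "x \<in> {3*b<..<4*b}"
      using that by (simp add: F_def F1_def algebra_simps)
    show "F x = - (K (x - 4 * b) * (E (x - 4 * b) * cs \<rho> (x - 2 * b)))" if "x \<in> {4*b<..<5*b}"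
      using that by (auto simp: F_def F2_def algebra_simps)
    show "F x = h (x - 5 * b) * conv (sn \<rho>) F (x - 2 * b)" if "x \<in> {5*b<..<6*b}"
      using that conv_F_z[of "x - 5 * b"] b by (auto simp: F_def F3_def algebra_simps)
    show "F x = 0" if "x \<notin> {3*b<..<4*b} \<union> {4*b<..<5*b} \<union> {5*b<..<6*b}"
      using that by (auto simp: F_def)
    show "conv (sn \<rho>) F x = 0" if "x \<le> 3 * b"
    proof -
      have "indicator {0<..<x} t *\<^sub>R (F t * sn \<rho> (x - t)) = 0" for t
        using that b by (auto simp: F_def indicator_def)
      then show ?thesis unfolding conv_def set_lebesgue_integral_def by (simp only: integral_zero)
    qed
  next
    show "conv (sn \<rho>) F X = 0"
      by (rule F_conv_0) (auto intro!: continuous_intros simp: sn_add sn_diff)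
    show "conv (cs \<rho>) F X = 0"
      by (rule F_conv_0) (auto intro!: continuous_intros simp: cs_add cs_diff)
  qed
qed

text \<open>The new solution is \<open>y + (\<beta> - \<alpha>) z\<close> with
  \<open>z = conv (sn \<rho>) F\<close>. The forcing term \<open>F\<close> depends on neither
  parameter, and \<open>z\<close> and its derivative vanish at 0 and at \<open>pi\<close>, so the
  data at both ends persist.\<close>

lemma delay_solution_change_parameter:
  fixes a :: real and h\<^sub>1 e\<^sub>1 :: "real \<Rightarrow> complex"
  assumes a: "0 < a" "a < pi / 3"
    and h: "set_integrable lebesgue {5*a/2<..<3*a} h\<^sub>1"
    and e: "set_integrable lebesgue {3*a/2<..<2*a} e\<^sub>1"
    and eig: "AE x in lebesgue. x \<in> {3*a/2<..<2*a} \<longrightarrow> M_op a h\<^sub>1 e\<^sub>1 x = - e\<^sub>1 x"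
    and mean: "(LINT x:{3*a/2<..<2*a}|lebesgue. e\<^sub>1 x) = 0"
    and sol: "delay_solution a (q_alpha a h\<^sub>1 e\<^sub>1 \<alpha>) \<mu> y dy" and init: "y 0 = 1" "dy 0 = 0"
  obtains y' dy' where "delay_solution a (q_alpha a h\<^sub>1 e\<^sub>1 \<beta>) \<mu> y' dy'" "y' 0 = 1" "dy' 0 = 0"
    "y' pi = y pi" "dy' pi = dy pi"
proof -
  define b where "b = a / 2"
  have ab: "a = 2 * b" and b: "0 < b" "6 * b < pi"
    using a by (simp_all add: b_def)
  have I: "{3*a/2<..<2*a} = {3*b<..<4*b}" "{2*a<..<5*a/2} = {4*b<..<5*b}"
      "{5*a/2<..<3*a} = {5*b<..<6*b}"
    by (simp_all add: b_def)
  define \<rho> where "\<rho> = csqrt \<mu>"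
  have \<mu>: "\<mu> = \<rho>\<^sup>2" by (simp add: \<rho>_def)
  \<comment> \<open>Cutting \<open>e\<close> off outside \<open>(0, b)\<close> makes its primitive
    \<open>E\<close> continuous on the whole line.\<close>
  define e where "e = (\<lambda>x. indicator {0<..<b} x *\<^sub>R e\<^sub>1 (3 * b + x))"
  define h where "h = (\<lambda>x. h\<^sub>1 (5 * b + x))"
  define E where "E = (\<lambda>x. LINT t:{0<..<x}|lebesgue. e t)"
  define K where "K = (\<lambda>x. LINT t:{x<..<b}|lebesgue. h t)"
  have e_int: "integrable lebesgue e"
    using set_integrable_shift[of "3 * b" 0 b e\<^sub>1] \<open>set_integrable lebesgue {3*a/2<..<2*a} e\<^sub>1\<close>
    by (simp add: e_def set_integrable_def I)
  have h_int: "set_integrable lebesgue {0<..<b} h"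
    using set_integrable_shift[of "5 * b" 0 b h\<^sub>1] \<open>set_integrable lebesgue {5*a/2<..<3*a} h\<^sub>1\<close>
    by (simp add: h_def I)
  have E_eq: "E x = (LINT t:{3 * b<..<3 * b + x}|lebesgue. e\<^sub>1 t)" if "x \<le> b" for x
  proof -
    have "E x = (LINT t:{0<..<x}|lebesgue. e\<^sub>1 (3 * b + t))"
      unfolding E_def by (rule set_lebesgue_integral_cong) (use that in \<open>auto simp: e_def\<close>)
    then show ?thesis
      using set_integral_shift[of 0 x e\<^sub>1 "3 * b"] by simp
  qed
  have K_eq: "K_fun a h\<^sub>1 (5 * b + x) = K x" for x
    using set_integral_shift[of x b h\<^sub>1 "5 * b"] by (simp add: K_fun_def K_def h_def ab)
  have M_eq: "M_op a h\<^sub>1 e\<^sub>1 (3 * b + x) = (LINT t:{0<..<b - x}|lebesgue. K (x + t) * e t)"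
    if "x \<in> {0<..<b}" for x
  proof -
    \<comment> \<open>With \<open>a = 2b\<close>, translating both variables by \<open>3b\<close>
      turns the argument \<open>x + t - a/2\<close> of \<open>K_fun\<close> into
      \<open>5b + x + t\<close> and the upper limit \<open>7a/2 - x\<close> into
      \<open>b - x\<close>.\<close>
    have "M_op a h\<^sub>1 e\<^sub>1 (3 * b + x)
        = (LINT t:{3 * b + 0<..<3 * b + (b - x)}|lebesgue. K_fun a h\<^sub>1 (2 * b + x + t) * e\<^sub>1 t)"
      unfolding M_op_def by (simp add: ab algebra_simps)
    also have "\<dots> = (LINT t:{0<..<b - x}|lebesgue. K_fun a h\<^sub>1 (2 * b + x + (3 * b + t)) * e\<^sub>1 (3 * b + t))"
      by (rule set_integral_shift[symmetric])
    also have "\<dots> = (LINT t:{0<..<b - x}|lebesgue. K (x + t) * e t)"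
      by (rule set_lebesgue_integral_cong)
         (use that in \<open>auto simp: K_eq[symmetric] e_def algebra_simps\<close>)
    finally show ?thesis .
  qed
  have eig': "AE x in lebesgue. x \<in> {0<..<b} \<longrightarrow>
      (LINT t:{0<..<b - x}|lebesgue. K (x + t) * e t) = - e x"
    using AE_lebesgue_shift[OF eig, of "3 * b"]
  proof eventually_elim
    case (elim x)
    then show ?case using M_eq[of x] by (auto simp: I e_def)
  qed
  have mean': "(LINT t:{0<..<b}|lebesgue. e t) = 0"
    using mean E_eq[of b] by (simp add: I E_def)
  obtain F where F_int: "set_integrable lebesgue {0<..<pi} F"
    and F1: "\<And>x. x \<in> {3*b<..<4*b} \<Longrightarrow> F x = e (x - 3 * b) * cs \<rho> (x - 2 * b)"
    and F2: "\<And>x. x \<in> {4*b<..<5*b} \<Longrightarrow> F x = - (K (x - 4 * b) * (E (x - 4 * b) * cs \<rho> (x - 2 * b)))"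
    and F3: "\<And>x. x \<in> {5*b<..<6*b} \<Longrightarrow> F x = h (x - 5 * b) * conv (sn \<rho>) F (x - 2 * b)"
    and F0: "\<And>x. x \<notin> {3*b<..<4*b} \<union> {4*b<..<5*b} \<union> {5*b<..<6*b} \<Longrightarrow> F x = 0"
    and z0: "\<And>x. x \<le> 3 * b \<Longrightarrow> conv (sn \<rho>) F x = 0"
    and end0: "conv (sn \<rho>) F pi = 0" "conv (cs \<rho>) F pi = 0"
    using forcing_term_orthogonal[OF b e_int h_int E_def[THEN fun_cong] K_def[THEN fun_cong] eig' mean'] by blast
  define \<delta> where "\<delta> = \<beta> - \<alpha>"
  define z where "z = conv (sn \<rho>) F"
  define y' where "y' = (\<lambda>x. y x + \<delta> * z x)"
  define dy' where "dy' = (\<lambda>x. dy x + \<delta> * conv (cs \<rho>) F x)"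
  note Z = conv_sn_solves[OF F_int, of _ \<rho>]
  have y_cs: "y x = cs \<rho> x" if "x \<in> {0..3 * b}" for x
    by (rule delay_solution_initial_segment[OF sol[unfolded \<mu>] init _ _ that])
       (use b in \<open>auto simp: q_alpha_def I\<close>)
  \<comment> \<open>The difference of the delayed terms for the two parameters. For \<open>x\<close>
    in \<open>(3b, 5b)\<close> the point \<open>x - 2b\<close> lies below \<open>3b\<close>, where
    \<open>y\<close> is the cosine and \<open>z\<close> is 0, so only the change of potential acts.
    On \<open>(5b, 6b)\<close> the potential is the same for both parameters and only the delayed
    \<open>z\<close> acts.\<close>
  have force: "(q_alpha a h\<^sub>1 e\<^sub>1 \<beta> x - q_alpha a h\<^sub>1 e\<^sub>1 \<alpha> x) * y (x - a)
      + q_alpha a h\<^sub>1 e\<^sub>1 \<beta> x * (\<delta> * z (x - a)) = \<delta> * F x" for x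
  proof -
    consider "x \<in> {3*b<..<4*b}" | "x \<in> {4*b<..<5*b}" | "x \<in> {5*b<..<6*b}"
      | "x \<notin> {3*b<..<4*b} \<union> {4*b<..<5*b} \<union> {5*b<..<6*b}" by auto
    then show ?thesis
    proof cases
      case 1
      have "q_alpha a h\<^sub>1 e\<^sub>1 \<gamma> x = \<gamma> * e (x - 3 * b)" for \<gamma>
        using 1 by (simp add: q_alpha_def I e_def)
      then show ?thesis
        using 1 y_cs[of "x - a"] z0[of "x - a"] by (simp add: F1 \<delta>_def z_def ab algebra_simps)
    next
      case 2
      have "K_fun a h\<^sub>1 (x + a / 2) = K (x - 4 * b)"
        using K_eq[of "x - 4 * b"] by (simp add: ab algebra_simps)
      moreover have "(LINT t:{3*a/2<..<x - a/2}|lebesgue. e\<^sub>1 t) = E (x - 4 * b)"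
        using E_eq[of "x - 4 * b"] 2 by (simp add: ab algebra_simps)
      ultimately have "q_alpha a h\<^sub>1 e\<^sub>1 \<gamma> x = - \<gamma> * K (x - 4 * b) * E (x - 4 * b)" for \<gamma>
        using 2 by (auto simp: q_alpha_def I)
      then show ?thesis
        using 2 y_cs[of "x - a"] z0[of "x - a"] by (simp add: F2 \<delta>_def z_def ab algebra_simps)
    next
      case 3
      then have "q_alpha a h\<^sub>1 e\<^sub>1 \<gamma> x = h (x - 5 * b)" for \<gamma>
        by (auto simp: q_alpha_def I h_def)
      with 3 show ?thesis
        by (simp add: F3 z_def ab)
    next
      case 4
      then have "q_alpha a h\<^sub>1 e\<^sub>1 \<gamma> x = 0" for \<gamma>
        by (auto simp: q_alpha_def I)
      with F0[OF 4] show ?thesis by simp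
    qed
  qed
  obtain ddy where ddy: "set_integrable lebesgue {0<..<pi} ddy"
    and dy: "\<And>x. x \<in> {0..pi} \<Longrightarrow> dy x = dy 0 + (LINT t:{0<..<x}|lebesgue. ddy t)"
    and eq: "AE x in lebesgue. x \<in> {0<..<pi} \<longrightarrow> - ddy x + q_alpha a h\<^sub>1 e\<^sub>1 \<alpha> x * y (x - a) = \<mu> * y x"
    and y: "\<And>x. x \<in> {0..pi} \<Longrightarrow> (y has_vector_derivative dy x) (at x within {0..pi})"
    using sol unfolding delay_solution_def by blast
  define ddy' where "ddy' = (\<lambda>x. ddy x + \<delta> * (F x - \<rho>\<^sup>2 * z x))"
  have ddz_int: "set_integrable lebesgue {0<..<pi} (\<lambda>t. \<delta> * (F t - \<rho>\<^sup>2 * z t))"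
    using Z(2)[of 0] unfolding z_def by (intro set_integrable_mult_right) simp
  have "delay_solution a (q_alpha a h\<^sub>1 e\<^sub>1 \<beta>) \<mu> y' dy'"
    unfolding delay_solution_def
  proof (intro conjI exI ballI)
    fix x :: real assume x: "x \<in> {0..pi}"
    show "(y' has_vector_derivative dy' x) (at x within {0..pi})"
      unfolding y'_def dy'_def z_def
      by (intro has_vector_derivative_add has_vector_derivative_mult_right y Z(1) x)
    have "set_integrable lebesgue {0<..<x} ddy"
        "set_integrable lebesgue {0<..<x} (\<lambda>t. \<delta> * (F t - \<rho>\<^sup>2 * z t))"
      using x by (auto intro: set_integrable_subset[OF ddy] set_integrable_subset[OF ddz_int])
    then have "(LINT t:{0<..<x}|lebesgue. ddy' t)
        = (LINT t:{0<..<x}|lebesgue. ddy t) + \<delta> * conv (cs \<rho>) F x"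
      unfolding ddy'_def Z(3)[OF x] z_def[symmetric] by (subst set_integral_add(2)) simp_all
    moreover have "conv (cs \<rho>) F 0 = 0" by (simp add: conv_def set_lebesgue_integral_def)
    ultimately show "dy' x = dy' 0 + (LINT t:{0<..<x}|lebesgue. ddy' t)"
      using dy[OF x] by (simp add: dy'_def)
  next
    show "set_integrable lebesgue {0<..<pi} ddy'"
      unfolding ddy'_def by (intro set_integral_add(1) ddy ddz_int)
    show "AE x in lebesgue. x \<in> {0<..<pi} \<longrightarrow>
        - ddy' x + q_alpha a h\<^sub>1 e\<^sub>1 \<beta> x * y' (x - a) = \<mu> * y' x"
      using eq
    proof eventually_elim
      case (elim x)
      then show ?case
        using force[of x] unfolding ddy'_def y'_def \<mu> by (auto simp: algebra_simps)
    qed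
  qed
  moreover have "conv c F 0 = 0" for c by (simp add: conv_def set_lebesgue_integral_def)
  ultimately show thesis
    using that[of y' dy'] init end0 by (simp add: y'_def dy'_def z_def)
qed

section \<open>Equality of the characteristic functions and of the spectra\<close>

theorem theorem2:
  fixes a :: real and h :: "real \<Rightarrow> real" and \<eta> :: complex
    and h\<^sub>1 e\<^sub>1 :: "real \<Rightarrow> complex"
  assumes "0 < a" and "a < pi / 3"
    and "L2_on (5*a/2) (3*a) h" and "\<not> ae_zero_on (5*a/2) (3*a) h"
    and "M_eigenvalue a (\<lambda>x. complex_of_real (h x)) \<eta>" and "\<eta> \<noteq> 0"
    and "h\<^sub>1 = (\<lambda>x. - complex_of_real (h x) / \<eta>)"
    and "M_eigenfunction a h\<^sub>1 (-1) e\<^sub>1"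
    and "(LINT x:{3*a/2<..<2*a}|lebesgue. e\<^sub>1 x) = 0"
  shows "\<forall>j\<in>{0, 1}. \<forall>\<alpha> \<beta>.
    spectrum a (q_alpha a h\<^sub>1 e\<^sub>1 \<alpha>) j = spectrum a (q_alpha a h\<^sub>1 e\<^sub>1 \<beta>) j"
proof -
  have "set_integrable lebesgue {5*a/2<..<3*a} h"
    using assms(3) by (rule L2_on_imp_set_integrable)
  then have "set_integrable lebesgue {5*a/2<..<3*a} (\<lambda>x. complex_of_real (h x))"
    unfolding set_integrable_def
    by (drule_tac integrable_of_real[where 'a=complex]) (simp add: scaleR_conv_of_real)
  from set_integrable_mult_right[OF this, of "- 1 / \<eta>"]
  have h: "set_integrable lebesgue {5*a/2<..<3*a} h\<^sub>1"
    by (simp add: assms(7))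
  have e: "set_integrable lebesgue {3*a/2<..<2*a} e\<^sub>1"
    and eig: "AE x in lebesgue. x \<in> {3*a/2<..<2*a} \<longrightarrow> M_op a h\<^sub>1 e\<^sub>1 x = - e\<^sub>1 x"
    using assms(8) L2_on_imp_set_integrable by (auto simp: M_eigenfunction_def)
  \<comment> \<open>\<open>char_fun\<close> is a description over this set of terminal values, so it
    suffices that the set is the same for all parameters; one inclusion for arbitrary parameters
    gives both. Multiplicities then agree because the characteristic functions coincide as functions
    and so have the same \<open>zorder\<close>.\<close>
  define D where "D = (\<lambda>\<alpha> j \<mu>. {d. \<exists>y dy. delay_solution a (q_alpha a h\<^sub>1 e\<^sub>1 \<alpha>) \<mu> y dy \<and>
      y 0 = 1 \<and> dy 0 = 0 \<and> d = (if j = (0::nat) then y pi else dy pi)})"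
  have "D \<alpha> j \<mu> \<subseteq> D \<beta> j \<mu>" for \<alpha> \<beta> j \<mu>
  proof
    fix d assume "d \<in> D \<alpha> j \<mu>"
    then obtain y dy where "delay_solution a (q_alpha a h\<^sub>1 e\<^sub>1 \<alpha>) \<mu> y dy" "y 0 = 1" "dy 0 = 0"
      and d: "d = (if j = 0 then y pi else dy pi)"
      unfolding D_def by blast
    from delay_solution_change_parameter[OF assms(1,2) h e eig assms(9) this(1-3)]
    obtain y' dy' where "delay_solution a (q_alpha a h\<^sub>1 e\<^sub>1 \<beta>) \<mu> y' dy'" "y' 0 = 1" "dy' 0 = 0"
      "y' pi = y pi" "dy' pi = dy pi" by metis
    then show "d \<in> D \<beta> j \<mu>"
      unfolding D_def d by (intro CollectI exI[of _ y'] exI[of _ dy']) simp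
  qed
  then have D: "D \<alpha> j \<mu> = D \<beta> j \<mu>" for \<alpha> \<beta> j \<mu>
    by (intro equalityI)
  have char: "char_fun a (q_alpha a h\<^sub>1 e\<^sub>1 \<alpha>) j = (\<lambda>\<mu>. THE d. d \<in> D \<alpha> j \<mu>)" for \<alpha> j
    by (simp add: char_fun_def[abs_def] D_def)
  show ?thesis
  proof (intro ballI allI)
    fix j \<alpha> \<beta>
    have "char_fun a (q_alpha a h\<^sub>1 e\<^sub>1 \<alpha>) j = char_fun a (q_alpha a h\<^sub>1 e\<^sub>1 \<beta>) j"
      unfolding char by (intro ext) (simp only: D[of \<alpha> j _ \<beta>])
    then show "spectrum a (q_alpha a h\<^sub>1 e\<^sub>1 \<alpha>) j = spectrum a (q_alpha a h\<^sub>1 e\<^sub>1 \<beta>) j"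
      unfolding spectrum_def by (simp only:)
  qed
qed

end
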